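(* Let $d\ge 1$. Suppose that two remaining problems (in the sense defined in the context) satisfy the complete-cycle elimination condition and have the same normalized histogram $H=(H_{a,r})_{a\ge 1,\,1\le r\le d}$. Then their numbers of invariant completions are equal. Thus the number $\Phi(H)$ of invariant completions of a remaining problem with histogram $H$ does not depend on the identities of the active cycles, on their chosen starting positions, or on the history of previously eliminated cycles.
   Context: All graphs are finite, simple and undirected. Fix an integer $d\ge1$. A remaining problem consists of: a finite set $X$ with a permutation $\pi$ of $X$; target degrees $\tau:X\to\{0,\dots,d\}$ constant on the cycles of $\pi$; a $\pi$-invariant set $A\subseteq X$ of active vertices (a union of complete cycles of $\pi$, fixed points being cycles of length 1), the other cycles having been eliminated; and a division of the unordered pairs of distinct elements of $X$ into decided and undecided pairs, where the decided pairs form a $\pi$-invariant set and a $\pi$-invariant subset $E_0$ of the decided pairs has been chosen as edges. For $v\in X$ the residual degree is $\rho(v)=\tau(v)-\#\{e\in E_0: v\in e\}$; it is constant on cycles of $\pi$. It is required that $\rho(v)=0$ for $v\notin A$, and (normalization: cycles of residual degree zero are removed from the active set) $1\le\rho(v)\le d$ for $v\in A$. The complete-cycle elimination condition says that every pair with at least one endpoint outside $A$ is already decided and that every pair of distinct vertices of $A$ is still undecided. The normalized histogram of the problem is the finitely supported array $H=(H_{a,r})_{a\ge1,\,1\le r\le d}$, where $H_{a,r}$ is the number of cycles of $\pi$ contained in $A$ that have length $a$ and whose vertices have residual degree $r$. An invariant completion is a set of undecided pairs that is invariant under $\pi$ (acting on unordered pairs) such that each $v\in A$ lies in exactly $\rho(v)$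 of its pairs. *)

theory Defs
  imports "HOL-Combinatorics.Orbits" "HOL-Library.Ramsey"
begin

text \<open>
  Unordered pairs of distinct elements of \<open>X\<close> are the two-element subsets
  \<open>[X]\<^bsup>2\<^esup> = nsets X 2\<close>; a permutation acts on them by taking images.
\<close>

record 'a problem =
  verts :: "'a set"
  perm :: "'a \<Rightarrow> 'a"
  target :: "'a \<Rightarrow> nat"
  active :: "'a set"
  decided :: "'a set set"
  chosen :: "'a set set"

definition undecided :: "'a problem \<Rightarrow> 'a set set" where
  "undecided P = [verts P]\<^bsup>2\<^esup> - decided P"

definition pairs_invariant :: "('a \<Rightarrow> 'a) \<Rightarrow> 'a set set \<Rightarrow> bool" where
  "pairs_invariant p F \<longleftrightarrow> (\<lambda>e. p ` e) ` F = F"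

text \<open>
  The residual degree is an integer, so that the subtraction does not truncate.
\<close>

definition residual :: "'a problem \<Rightarrow> 'a \<Rightarrow> int" where
  "residual P v = int (target P v) - int (card {e \<in> chosen P. v \<in> e})"

text \<open>
  For a permutation of a finite set, \<open>orbit p v\<close> contains \<open>v\<close>, so these orbits are
  the cycles, fixed points included.
\<close>

definition cycles :: "'a problem \<Rightarrow> 'a set set" where
  "cycles P = orbit (perm P) ` verts P"

definition remaining_problem :: "nat \<Rightarrow> 'a problem \<Rightarrow> bool" where
  "remaining_problem d P \<longleftrightarrow>
     finite (verts P) \<and>
     perm P permutes verts P \<and>
     (\<forall>v\<in>verts P. target P v \<le> d) \<and>
     (\<forall>C\<in>cycles P. \<forall>u\<in>C. \<forall>v\<in>C. target P u = target P v) \<and>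
     active P \<subseteq> verts P \<and>
     perm P ` active P = active P \<and>
     decided P \<subseteq> [verts P]\<^bsup>2\<^esup> \<and>
     pairs_invariant (perm P) (decided P) \<and>
     chosen P \<subseteq> decided P \<and>
     pairs_invariant (perm P) (chosen P) \<and>
     (\<forall>v\<in>verts P - active P. residual P v = 0) \<and>
     (\<forall>v\<in>active P. 1 \<le> residual P v \<and> residual P v \<le> int d)"

definition complete_cycle_elimination :: "'a problem \<Rightarrow> bool" where
  "complete_cycle_elimination P \<longleftrightarrow>
     (\<forall>e\<in>[verts P]\<^bsup>2\<^esup>. (\<exists>v\<in>e. v \<notin> active P) \<longrightarrow> e \<in> decided P) \<and>
     (\<forall>e\<in>[active P]\<^bsup>2\<^esup>. e \<in> undecided P)"

text \<open>
  Arrays indexed by \<open>a \<ge> 1\<close> and \<open>1 \<le> r \<le> d\<close> are functions that vanish outside this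
  index range.
\<close>

definition histogram :: "nat \<Rightarrow> 'a problem \<Rightarrow> nat \<Rightarrow> nat \<Rightarrow> nat" where
  "histogram d P a r =
     (if 1 \<le> a \<and> 1 \<le> r \<and> r \<le> d
      then card {C \<in> cycles P. C \<subseteq> active P \<and> card C = a \<and> (\<forall>v\<in>C. residual P v = int r)}
      else 0)"

definition invariant_completions :: "'a problem \<Rightarrow> 'a set set set" where
  "invariant_completions P =
     {F. F \<subseteq> undecided P \<and> pairs_invariant (perm P) F \<and>
         (\<forall>v\<in>active P. int (card {e \<in> F. v \<in> e}) = residual P v)}"

text \<open>
  A definition cannot quantify over all carrier types at once; \<^typ>\<open>nat\<close> contains a copy
  of every finite set, hence of every remaining problem. The description is meaningful
  only once the number of completions is known to depend on the histogram alone.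
\<close>

definition Phi :: "nat \<Rightarrow> (nat \<Rightarrow> nat \<Rightarrow> nat) \<Rightarrow> nat" where
  "Phi d H = (THE n. \<exists>R :: nat problem.
     remaining_problem d R \<and> complete_cycle_elimination R \<and> histogram d R = H \<and>
     n = card (invariant_completions R))"

end

theory Submission
  imports Defs
begin

text \<open>
  After complete-cycle elimination the undecided pairs are exactly the pairs of active vertices,
  so the completions only depend on the active set, the permutation restricted to it and the
  residual degrees. Equal histograms give a bijection of the active cycles that preserves length
  and residual degree; choosing a starting point in every cycle turns it into an equivariant
  bijection of the active vertices, and this bijection transports completions. For \<open>Phi\<close> it
  remains to copy the active part of a problem to \<^typ>\<open>nat\<close>, where the residual degrees become
  the target degrees and no pair is decided.
\<close>

section \<open>Matching labelled finite sets and matching single cycles\<close>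

text \<open>The fibres of \<open>k\<close> partition \<open>A\<close> and those of \<open>l\<close>
  partition \<open>B\<close>, so bijections chosen fibre by fibre glue together. It is applied with
  cycles as elements and their length and residual degree as label.\<close>

lemma bij_betw_of_card_fibres:
  assumes "finite A" "finite B"
    and card_eq: "\<And>y. card {x \<in> A. k x = y} = card {x \<in> B. l x = y}"
  obtains g where "bij_betw g A B" "\<And>x. x \<in> A \<Longrightarrow> l (g x) = k x"
proof -
  have "\<exists>h. bij_betw h {x \<in> A. k x = y} {x \<in> B. l x = y}" for y
    using assms by (intro finite_same_card_bij) auto
  then obtain h where h: "\<And>y. bij_betw (h y) {x \<in> A. k x = y} {x \<in> B. l x = y}"
    by metis
  define g where "g x = h (k x) x" for x
  have g: "g x \<in> B" "l (g x) = k x" if "x \<in> A" for x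
    using bij_betwE[OF h[of "k x"]] that by (auto simp: g_def)
  have "inj_on g A"
  proof (rule inj_onI)
    fix x y assume xy: "x \<in> A" "y \<in> A" "g x = g y"
    then have "k x = k y" using g by metis
    with xy show "x = y"
      using bij_betw_imp_inj_on[OF h[of "k x"]] by (auto simp: g_def dest: inj_onD)
  qed
  moreover have "g ` A = B"
  proof
    show "g ` A \<subseteq> B" using g by blast
    show "B \<subseteq> g ` A"
    proof
      fix z assume "z \<in> B"
      then have "z \<in> h (l z) ` {x \<in> A. k x = l z}"
        using bij_betw_imp_surj_on[OF h[of "l z"]] by simp
      then obtain x where "x \<in> A" "k x = l z" "z = h (l z) x" by blast
      then have "z = g x" by (simp add: g_def)
      with \<open>x \<in> A\<close> show "z \<in> g ` A" by blast
    qed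
  qed
  ultimately show thesis using g that by (simp add: bij_betw_def)
qed

text \<open>The iterates before the first return to \<open>x\<close> are distinct and exhaust the
  orbit, so the return time is the length of the cycle and exponents matter only modulo it.\<close>

lemma funpow_eq_iff_mod_card_orbit:
  assumes "x \<in> orbit f x"
  shows "(f ^^ m) x = (f ^^ n) x \<longleftrightarrow> m mod card (orbit f x) = n mod card (orbit f x)"
proof -
  \<comment> \<open>The first return time; \<open>funpow_dist1\<close> is a successor, so the
    modulus is positive.\<close>
  let ?k = "funpow_dist1 f x x"
  have inj: "inj_on (\<lambda>n. (f ^^ n) x) {0..<?k}"
    using assms by (rule inj_on_funpow_dist1)
  have "card (orbit f x) = ?k"
    using card_image[OF inj] orbit_conv_funpow_dist1[OF assms] by simp
  moreover have "(f ^^ m) x = (f ^^ (m mod ?k)) x" for m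
    using funpow_dist1_prop[OF assms] by (simp only: funpow_mod_eq)
  ultimately show ?thesis
    using inj_onD[OF inj, of "m mod ?k" "n mod ?k"] by (metis atLeastLessThan_iff
      le0 mod_less_divisor zero_less_Suc)
qed

text \<open>With starting points \<open>x\<close> and \<open>y\<close>, send
  \<open>(p ^^ n) x\<close> to \<open>(q ^^ n) y\<close>. As the lengths agree, two exponents give
  the same vertex of one cycle iff they do so on the other, which yields both well-definedness and
  injectivity.\<close>

lemma equivariant_bij_betw_orbits:
  assumes x: "x \<in> orbit p x" and y: "y \<in> orbit q y"
    and card_eq: "card (orbit p x) = card (orbit q y)"
  obtains f where "bij_betw f (orbit p x) (orbit q y)"
    "\<And>v. v \<in> orbit p x \<Longrightarrow> f (p v) = q (f v)"
proof -
  \<comment> \<open>The least exponent leading from \<open>x\<close> to \<open>v\<close> is used;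
    the next fact shows that every other exponent gives the same value.\<close>
  define f where "f v = (q ^^ funpow_dist p x v) y" for v
  have f: "f ((p ^^ n) x) = (q ^^ n) y" for n
  proof -
    have "(p ^^ n) x \<in> orbit p x" using x by (rule funpow_in_orbit)
    from funpow_dist_prop[OF this] show ?thesis
      unfolding f_def funpow_eq_iff_mod_card_orbit[OF x] funpow_eq_iff_mod_card_orbit[OF y]
      by (simp add: card_eq)
  qed
  have px: "orbit p x = range (\<lambda>n. (p ^^ n) x)" and qy: "orbit q y = range (\<lambda>n. (q ^^ n) y)"
    using orbit_altdef_self_in[OF x] orbit_altdef_self_in[OF y] by auto
  have "inj_on f (orbit p x)"
    unfolding px by (auto simp: inj_on_def f funpow_eq_iff_mod_card_orbit[OF x]
        funpow_eq_iff_mod_card_orbit[OF y] card_eq)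
  moreover have "f ` orbit p x = orbit q y"
    unfolding px qy image_image f ..
  moreover have "f (p v) = q (f v)" if "v \<in> orbit p x" for v
  proof -
    obtain n where "v = (p ^^ n) x" using \<open>v \<in> orbit p x\<close> px by auto
    then show ?thesis using f[of n] f[of "Suc n"] by simp
  qed
  ultimately show thesis by (intro that) (auto simp: bij_betw_def)
qed

section \<open>Isomorphisms of active parts\<close>

text \<open>Targets, decided pairs and chosen edges enter only through \<open>residual\<close>, so
  problems with different histories can be isomorphic. Nothing is demanded of \<open>f\<close>
  outside \<open>active P\<close>.\<close>

definition active_iso :: "('a \<Rightarrow> 'b) \<Rightarrow> 'a problem \<Rightarrow> 'b problem \<Rightarrow> bool" where
  "active_iso f P Q \<longleftrightarrow>
     bij_betw f (active P) (active Q) \<and>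
     (\<forall>v\<in>active P. f (perm P v) = perm Q (f v) \<and> residual Q (f v) = residual P v)"

definition active_cycles :: "'a problem \<Rightarrow> 'a set set" where
  "active_cycles P = {C \<in> cycles P. C \<subseteq> active P}"

text \<open>One half of the elimination condition rules out undecided pairs that leave
  \<open>active P\<close>, the other makes all pairs inside it undecided. After this the history is
  visible only in the residual degrees.\<close>

lemma undecided_eq:
  assumes "remaining_problem d P" "complete_cycle_elimination P"
  shows "undecided P = [active P]\<^bsup>2\<^esup>"
proof
  show "[active P]\<^bsup>2\<^esup> \<subseteq> undecided P"
    using assms by (auto simp: complete_cycle_elimination_def)
  show "undecided P \<subseteq> [active P]\<^bsup>2\<^esup>"
  proof
    fix e assume e: "e \<in> undecided P"
    then have "e \<in> [verts P]\<^bsup>2\<^esup>" "e \<notin> decided P" by (auto simp: undecided_def)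
    then have "e \<subseteq> active P" using assms(2) by (auto simp: complete_cycle_elimination_def)
    with e show "e \<in> [active P]\<^bsup>2\<^esup>" by (auto simp: undecided_def nsets_def)
  qed
qed

section \<open>Active cycles of a single remaining problem\<close>

context
  fixes d and P :: "'a problem"
  assumes P: "remaining_problem d P"
begin

lemma perm_in_active: "v \<in> active P \<Longrightarrow> perm P v \<in> active P"
  using P by (auto simp: remaining_problem_def)

lemma active_subset: "active P \<subseteq> verts P" and finite_verts: "finite (verts P)"
  and perm_permutes: "perm P permutes verts P"
  using P by (auto simp: remaining_problem_def)

lemma finite_active: "finite (active P)"
  using active_subset finite_verts finite_subset by blast

lemma permutation_perm: "permutation (perm P)"
  using perm_permutes finite_verts by (auto simp: permutation_permutes)

lemma orbit_eq: "u \<in> orbit (perm P) v \<Longrightarrow> orbit (perm P) u = orbit (perm P) v"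
  using cyclic_on_orbit'[OF permutation_perm] by (rule orbit_cyclic_eq3)

lemma orbit_subset_active: "v \<in> active P \<Longrightarrow> orbit (perm P) v \<subseteq> active P"
proof
  fix u assume "v \<in> active P" "u \<in> orbit (perm P) v"
  from this(2,1) show "u \<in> active P" by induct (auto intro: perm_in_active)
qed

text \<open>Targets are constant on cycles, and \<open>perm P\<close> maps the chosen edges at
  \<open>v\<close> bijectively onto those at \<open>perm P v\<close>, being injective and preserving
  \<open>chosen P\<close>.\<close>

lemma residual_perm:
  assumes v: "v \<in> verts P"
  shows "residual P (perm P v) = residual P v"
proof -
  have inj: "inj (perm P)" using perm_permutes by (rule permutes_inj)
  have "orbit (perm P) v \<in> cycles P" using v by (simp add: cycles_def)
  moreover have "v \<in> orbit (perm P) v" "perm P v \<in> orbit (perm P) v"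
    using permutation_self_in_orbit[OF permutation_perm] by (auto intro: orbit.base)
  moreover have "\<forall>C\<in>cycles P. \<forall>u\<in>C. \<forall>v\<in>C. target P u = target P v"
    using P unfolding remaining_problem_def by (elim conjE)
  ultimately have target: "target P (perm P v) = target P v" by blast
  have "(\<lambda>e. perm P ` e) ` chosen P = chosen P"
    using P unfolding remaining_problem_def pairs_invariant_def by (elim conjE)
  then have "{e \<in> chosen P. perm P v \<in> e} = {e \<in> (\<lambda>e. perm P ` e) ` chosen P. perm P v \<in> e}"
    by simp
  also have "\<dots> = (\<lambda>e. perm P ` e) ` {e \<in> chosen P. v \<in> e}"
    using inj by (auto dest: injD)
  finally have "card {e \<in> chosen P. perm P v \<in> e} = card {e \<in> chosen P. v \<in> e}"
    by (simp add: card_image inj_on_def inj_image_eq_iff[OF inj])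
  with target show ?thesis by (simp add: residual_def)
qed

lemma residual_orbit:
  assumes "v \<in> active P" "u \<in> orbit (perm P) v"
  shows "residual P u = residual P v"
  using assms(2)
proof induct
  case base
  then show ?case using assms(1) active_subset residual_perm by blast
next
  case (step u)
  then have "u \<in> verts P" using orbit_subset_active[OF assms(1)] active_subset by blast
  with step show ?case using residual_perm by simp
qed

lemma active_cycles_eq: "active_cycles P = orbit (perm P) ` active P"
proof
  show "active_cycles P \<subseteq> orbit (perm P) ` active P"
    using permutation_self_in_orbit[OF permutation_perm]
    by (auto simp: active_cycles_def cycles_def)
  show "orbit (perm P) ` active P \<subseteq> active_cycles P"
    using active_subset orbit_subset_active by (auto simp: active_cycles_def cycles_def)
qed

lemma active_cyclesE:
  assumes "C \<in> active_cycles P"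
  obtains v where "v \<in> active P" "v \<in> orbit (perm P) v" "C = orbit (perm P) v"
  using assms permutation_self_in_orbit[OF permutation_perm] by (auto simp: active_cycles_eq)

lemma residual_cycle:
  assumes "C \<in> active_cycles P" "v \<in> C"
  shows "residual P ` C = {residual P v}"
proof -
  obtain x where x: "x \<in> active P" "C = orbit (perm P) x"
    using active_cyclesE[OF assms(1)] by metis
  then have "residual P u = residual P v" if "u \<in> C" for u
    using residual_orbit[OF x(1)] assms(2) that by simp
  with assms(2) show ?thesis by blast
qed

text \<open>
  Singleton sets of residual degrees serve as labels, which avoids choosing a vertex.
\<close>

lemma card_cycles_histogram:
  "card {C \<in> active_cycles P. (card C, residual P ` C) = (a, S)} =
     (if \<exists>r. S = {int r} then histogram d P a (THE r. S = {int r}) else 0)"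
proof (cases "\<exists>r. S = {int r}")
  case True
  then obtain r where S: "S = {int r}" by blast
  have lab: "residual P ` C = {int r} \<longleftrightarrow> (\<forall>v\<in>C. residual P v = int r)"
    if "C \<in> active_cycles P" for C
  proof -
    have "C \<noteq> {}" using active_cyclesE[OF that] by blast
    then show ?thesis by auto
  qed
  \<comment> \<open>Cycles are finite and nonempty, and active residual degrees lie between 1 and
    \<open>d\<close>. Hence no cycle has a label outside the index range, and the default 0 of
    \<open>histogram\<close> is the true count there.\<close>
  have range: "1 \<le> a \<and> 1 \<le> r \<and> r \<le> d"
    if C: "C \<in> active_cycles P" "card C = a" "residual P ` C = {int r}" for C
  proof -
    obtain v where v: "v \<in> active P" "v \<in> orbit (perm P) v" "C = orbit (perm P) v"
      using C active_cyclesE by blast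
    then have "card C \<ge> 1" using finite_orbit[OF v(2)]
      by (metis One_nat_def Suc_leI card_gt_0_iff empty_iff)
    moreover have "residual P v = int r" using C v by auto
    moreover have "1 \<le> residual P v \<and> residual P v \<le> int d"
      using P v(1) by (simp add: remaining_problem_def)
    ultimately show ?thesis using C(2) by simp
  qed
  have "{C \<in> active_cycles P. (card C, residual P ` C) = (a, S)} =
      {C \<in> cycles P. C \<subseteq> active P \<and> card C = a \<and> (\<forall>v\<in>C. residual P v = int r)}"
    using lab by (auto simp: S active_cycles_def)
  moreover have "{C \<in> active_cycles P. (card C, residual P ` C) = (a, S)} = {}"
    if "\<not> (1 \<le> a \<and> 1 \<le> r \<and> r \<le> d)"
    using range that by (fastforce simp: S)
  ultimately have "card {C \<in> active_cycles P. (card C, residual P ` C) = (a, S)} = histogram d P a r"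
    unfolding histogram_def by (cases "1 \<le> a \<and> 1 \<le> r \<and> r \<le> d")
      (simp_all only: if_True if_False card.empty simp_thms)
  then show ?thesis by (simp add: S)
next
  case False
  have "{C \<in> active_cycles P. (card C, residual P ` C) = (a, S)} = {}"
  proof -
    \<comment> \<open>The residual degree is a positive integer, so the label of an active cycle
      always comes from a natural number; any other label has an empty fibre.\<close>
    have "\<exists>r. residual P ` C = {int r}" if C: "C \<in> active_cycles P" for C
    proof -
      obtain v where "v \<in> active P" "v \<in> orbit (perm P) v" "C = orbit (perm P) v"
        using C by (rule active_cyclesE)
      then have v: "v \<in> active P" "v \<in> C" by simp_all
      from v(1) have "1 \<le> residual P v" using P by (simp add: remaining_problem_def)
      then have "residual P v = int (nat (residual P v))" by simp
      with residual_cycle[OF C v(2)] have "residual P ` C = {int (nat (residual P v))}" by simp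
      then show ?thesis ..
    qed
    with False show ?thesis by blast
  qed
  with False show ?thesis by (simp only: card.empty if_False)
qed

end

section \<open>Transport of completions and histograms\<close>

text \<open>With the inverse at hand, each transport lemma below only needs an inequality.\<close>

lemma active_iso_sym:
  assumes "remaining_problem d P" "active_iso f P Q"
  shows "active_iso (inv_into (active P) f) Q P"
proof -
  let ?g = "inv_into (active P) f"
  have f: "bij_betw f (active P) (active Q)" using assms by (simp add: active_iso_def)
  have "?g (perm Q w) = perm P (?g w) \<and> residual P (?g w) = residual Q w"
    if w: "w \<in> active Q" for w
  proof -
    obtain v where v: "v \<in> active P" "w = f v" using f w by (auto simp: bij_betw_def)
    moreover have "perm P v \<in> active P" using assms(1) v(1) by (rule perm_in_active)
    moreover have "f (perm P v) = perm Q w" "residual Q w = residual P v"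
      using assms(2) v by (auto simp: active_iso_def)
    ultimately show ?thesis
      using bij_betw_inv_into_left[OF f] by metis
  qed
  with bij_betw_inv_into[OF f] show ?thesis by (simp add: active_iso_def)
qed

text \<open>Applying \<open>f\<close> to every vertex of every pair maps completions of
  \<open>P\<close> injectively to completions of \<open>Q\<close>: equivariance preserves
  invariance, and injectivity on the active vertices preserves degrees.\<close>

lemma card_invariant_completions_le:
  assumes P: "remaining_problem d P" "complete_cycle_elimination P"
    and Q: "remaining_problem d Q" "complete_cycle_elimination Q"
    and iso: "active_iso f P Q"
  shows "card (invariant_completions P) \<le> card (invariant_completions Q)"
proof (rule card_inj_on_le)
  have bij: "bij_betw f (active P) (active Q)" and inj: "inj_on f (active P)"
    and onto: "f ` active P = active Q"
    using iso by (auto simp: active_iso_def bij_betw_def)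
  have inj2: "inj_on (\<lambda>e. f ` e) ([active P]\<^bsup>2\<^esup>)" using inj by (rule inj_on_nsets)
  have sub: "F \<subseteq> [active P]\<^bsup>2\<^esup>" if "F \<in> invariant_completions P" for F
    using that undecided_eq[OF P] by (auto simp: invariant_completions_def)
  show "inj_on (\<lambda>F. (\<lambda>e. f ` e) ` F) (invariant_completions P)"
    using inj_on_subset[OF inj_on_image_Pow[OF inj2]] sub by blast
  have "invariant_completions Q \<subseteq> Pow ([active Q]\<^bsup>2\<^esup>)"
    using undecided_eq[OF Q] by (auto simp: invariant_completions_def)
  then show "finite (invariant_completions Q)"
    using finite_active[OF Q(1)] finite_imp_finite_nsets finite_subset by blast
  show "(\<lambda>F. (\<lambda>e. f ` e) ` F) ` invariant_completions P \<subseteq> invariant_completions Q"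
  proof (rule image_subsetI)
    fix F assume F: "F \<in> invariant_completions P"
    let ?F = "(\<lambda>e. f ` e) ` F"
    have eP: "e \<subseteq> active P" if "e \<in> F" for e
      using sub[OF F] that by (auto simp: nsets_def)
    have "?F \<subseteq> undecided Q"
      using sub[OF F] bij_betw_nsets[OF bij, of 2] unfolding undecided_eq[OF Q]
      by (auto simp: bij_betw_def)
    moreover have "pairs_invariant (perm Q) ?F"
    proof -
      \<comment> \<open>Congruence through the set of pairs and then through each pair leaves
        equivariance at a single active vertex.\<close>
      have "(\<lambda>e. perm Q ` e) ` ?F = (\<lambda>e. f ` e) ` (\<lambda>e. perm P ` e) ` F"
        unfolding image_image
      proof (intro image_cong refl)
        fix e v assume "e \<in> F" "v \<in> e"
        then have "v \<in> active P" using eP by blast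
        then show "perm Q (f v) = f (perm P v)" using iso by (simp add: active_iso_def)
      qed
      then show ?thesis using F by (simp add: invariant_completions_def pairs_invariant_def)
    qed
    moreover have "int (card {e \<in> ?F. w \<in> e}) = residual Q w" if w: "w \<in> active Q" for w
    proof -
      obtain v where v: "v \<in> active P" "w = f v" using onto w by blast
      have "f v \<in> f ` e \<longleftrightarrow> v \<in> e" if "e \<in> F" for e
        using inj v(1) eP[OF that] by (rule inj_on_image_mem_iff)
      then have "{e \<in> ?F. w \<in> e} = (\<lambda>e. f ` e) ` {e \<in> F. v \<in> e}" using v by auto
      moreover have "inj_on (\<lambda>e. f ` e) {e \<in> F. v \<in> e}"
        using inj2 by (rule inj_on_subset) (use sub[OF F] in auto)
      ultimately have "card {e \<in> ?F. w \<in> e} = card {e \<in> F. v \<in> e}" by (simp add: card_image)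
      moreover have "int (card {e \<in> F. v \<in> e}) = residual P v"
        using F v by (simp add: invariant_completions_def)
      ultimately show ?thesis using iso v by (simp add: active_iso_def)
    qed
    ultimately show "?F \<in> invariant_completions Q" by (simp add: invariant_completions_def)
  qed
qed

text \<open>Images under \<open>f\<close> send active cycles injectively to active cycles of the
  same length and residual degree. This serves to show that the copy on \<open>nat\<close> has the
  original histogram.\<close>

lemma histogram_le:
  assumes P: "remaining_problem d P" and Q: "remaining_problem d Q" and iso: "active_iso f P Q"
  shows "histogram d P a r \<le> histogram d Q a r"
proof -
  let ?A = "{C \<in> cycles P. C \<subseteq> active P \<and> card C = a \<and> (\<forall>v\<in>C. residual P v = int r)}"
  let ?B = "{C \<in> cycles Q. C \<subseteq> active Q \<and> card C = a \<and> (\<forall>v\<in>C. residual Q v = int r)}"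
  have inj: "inj_on f (active P)" and onto: "f ` active P = active Q"
    and iso': "\<And>v. v \<in> active P \<Longrightarrow> f (perm P v) = perm Q (f v)"
      "\<And>v. v \<in> active P \<Longrightarrow> residual Q (f v) = residual P v"
    using iso by (auto simp: active_iso_def bij_betw_def)
  have "card ?A \<le> card ?B"
  proof (rule card_inj_on_le)
    show "inj_on (\<lambda>C. f ` C) ?A"
      by (rule inj_on_subset[OF inj_on_image_Pow[OF inj]]) auto
    show "finite ?B" using finite_verts[OF Q] by (simp add: cycles_def)
    show "(\<lambda>C. f ` C) ` ?A \<subseteq> ?B"
    proof (rule image_subsetI)
      fix C assume C: "C \<in> ?A"
      then have "C \<in> active_cycles P" by (simp add: active_cycles_def)
      then obtain v where v: "v \<in> active P" "v \<in> orbit (perm P) v" "C = orbit (perm P) v"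
        using active_cyclesE[OF P] by blast
      \<comment> \<open>\<open>orbit_inverse\<close> asks for equivariance along the orbit only, and
        the orbit stays inside \<open>active P\<close>.\<close>
      have "f ` C = orbit (perm Q) (f v)"
        unfolding v(3) using v(2)
        by (rule orbit_inverse) (use iso' orbit_subset_active[OF P v(1)] in auto)
      moreover have "f v \<in> verts Q" using onto v(1) active_subset[OF Q] by blast
      ultimately have "f ` C \<in> cycles Q" by (simp add: cycles_def)
      moreover have "card (f ` C) = card C"
        using C inj by (intro card_image) (auto intro: inj_on_subset)
      moreover have "f ` C \<subseteq> active Q" using C onto by blast
      ultimately show "f ` C \<in> ?B" using C iso'(2) by auto
    qed
  qed
  then show ?thesis by (simp add: histogram_def)
qed

lemma active_iso_imp_histogram_eq:
  assumes "remaining_problem d P" "remaining_problem d Q" "active_iso f P Q"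
  shows "histogram d P = histogram d Q"
  using histogram_le[OF assms] histogram_le[OF assms(2,1) active_iso_sym[OF assms(1,3)]]
  by (intro ext antisym)

section \<open>From equal histograms to an isomorphism\<close>

lemma histogram_eq_imp_active_iso:
  assumes P: "remaining_problem d P" and Q: "remaining_problem d Q"
    and hist: "histogram d P = histogram d Q"
  obtains f where "active_iso f P Q"
proof -
  let ?p = "perm P" and ?q = "perm Q"
  have fin: "finite (active_cycles P)" "finite (active_cycles Q)"
    using finite_active[OF P] finite_active[OF Q]
    by (simp_all add: active_cycles_eq[OF P] active_cycles_eq[OF Q])
  \<comment> \<open>Every fibre size is a histogram entry or 0, hence the same for both
    problems.\<close>
  have "card {C \<in> active_cycles P. (card C, residual P ` C) = y} =
      card {C \<in> active_cycles Q. (card C, residual Q ` C) = y}" for y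
    by (cases y) (simp only: card_cycles_histogram[OF P] card_cycles_histogram[OF Q] hist)
  from bij_betw_of_card_fibres[OF fin this] obtain g
    where g: "bij_betw g (active_cycles P) (active_cycles Q)"
      and g_label: "\<And>C. C \<in> active_cycles P \<Longrightarrow>
        (card (g C), residual Q ` g C) = (card C, residual P ` C)"
    by blast
  \<comment> \<open>The starting points \<open>x\<close> and \<open>y\<close> are arbitrary; any
    choice gives an equivariant bijection of the two cycles.\<close>
  have "\<exists>h. bij_betw h C (g C) \<and> (\<forall>v\<in>C. h (?p v) = ?q (h v))"
    if C: "C \<in> active_cycles P" for C
  proof -
    obtain x where x: "x \<in> orbit ?p x" "C = orbit ?p x"
      using active_cyclesE[OF P C] by metis
    have "g C \<in> active_cycles Q" using g C by (auto simp: bij_betw_def)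
    then obtain y where y: "y \<in> orbit ?q y" "g C = orbit ?q y"
      using active_cyclesE[OF Q] by metis
    have "card (orbit ?p x) = card (orbit ?q y)" using g_label[OF C] x y by simp
    from equivariant_bij_betw_orbits[OF x(1) y(1) this] show ?thesis
      unfolding x(2)[symmetric] y(2)[symmetric] by metis
  qed
  then obtain h where h: "\<And>C. C \<in> active_cycles P \<Longrightarrow> bij_betw (h C) C (g C)"
    and h_eq: "\<And>C v. C \<in> active_cycles P \<Longrightarrow> v \<in> C \<Longrightarrow> h C (?p v) = ?q (h C v)"
    by metis
  \<comment> \<open>Each vertex uses the bijection chosen for its own cycle.\<close>
  define f where "f v = h (orbit ?p v) v" for v
  have cyc: "orbit ?p v \<in> active_cycles P" if "v \<in> active P" for v
    using that by (simp add: active_cycles_eq[OF P])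
  have self: "v \<in> orbit ?p v" for v
    by (rule permutation_self_in_orbit[OF permutation_perm[OF P]])
  have f_in: "f v \<in> g (orbit ?p v)" if "v \<in> active P" for v
    using bij_betwE[OF h[OF cyc[OF that]]] self by (auto simp: f_def)
  have g_active: "g C \<in> active_cycles Q" if "C \<in> active_cycles P" for C
    using g that by (auto simp: bij_betw_def)
  have "inj_on f (active P)"
  proof (rule inj_onI)
    fix v w assume vw: "v \<in> active P" "w \<in> active P" "f v = f w"
    \<comment> \<open>The cycle through \<open>f v\<close> determines \<open>g (orbit ?p v)\<close>.
      Equal values therefore force equal cycles, as \<open>g\<close> is injective, and then a single
      injective \<open>h C\<close> decides.\<close>
    have "orbit ?q (f v) = C" if "C \<in> active_cycles Q" "f v \<in> C" for C
      using active_cyclesE[OF Q that(1)] orbit_eq[OF Q] that(2) by metis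
    then have "g (orbit ?p v) = g (orbit ?p w)"
      using f_in vw g_active cyc by metis
    then have "orbit ?p v = orbit ?p w"
      using g cyc vw by (auto simp: bij_betw_def dest: inj_onD)
    with vw show "v = w"
      using bij_betw_imp_inj_on[OF h[OF cyc[OF vw(1)]]] self[of v] self[of w]
      by (auto simp: f_def dest: inj_onD)
  qed
  moreover have "f ` active P = active Q"
  proof
    show "f ` active P \<subseteq> active Q"
      using f_in g_active[OF cyc] by (fastforce simp: active_cycles_def)
    show "active Q \<subseteq> f ` active P"
    proof
      fix w assume "w \<in> active Q"
      then have "orbit ?q w \<in> g ` active_cycles P"
        using g by (simp add: bij_betw_def active_cycles_eq[OF Q])
      then obtain C where C: "C \<in> active_cycles P" "g C = orbit ?q w" by auto
      have "w \<in> orbit ?q w"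
        by (rule permutation_self_in_orbit[OF permutation_perm[OF Q]])
      then have "w \<in> h C ` C" using C bij_betw_imp_surj_on[OF h[OF C(1)]] by simp
      then obtain v where v: "v \<in> C" "w = h C v" by blast
      have "orbit ?p v = C" using active_cyclesE[OF P C(1)] orbit_eq[OF P] v(1) by metis
      moreover have "v \<in> active P" using C v by (auto simp: active_cycles_def)
      ultimately show "w \<in> f ` active P" using v by (auto simp: f_def)
    qed
  qed
  \<comment> \<open>\<open>v\<close> and \<open>?p v\<close> lie on the same cycle, so
    \<open>f\<close> uses the same \<open>h C\<close> for both.\<close>
  moreover have "f (?p v) = ?q (f v)" if v: "v \<in> active P" for v
    using h_eq[OF cyc[OF v] self]
    by (simp add: f_def permutation_orbit_step[OF permutation_perm[OF P]])
  moreover have "residual Q (f v) = residual P v" if v: "v \<in> active P" for v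
  proof -
    have "residual Q ` g (orbit ?p v) = {residual P v}"
      using g_label[OF cyc[OF v]] residual_cycle[OF P cyc[OF v] self] by simp
    then show ?thesis using f_in[OF v] by auto
  qed
  ultimately have "active_iso f P Q" by (simp add: active_iso_def bij_betw_def)
  then show thesis by (rule that)
qed

section \<open>A copy of the active part on the natural numbers\<close>

text \<open>\<open>Phi\<close> ranges over problems on \<open>nat\<close> only, so a problem on any
  carrier needs a representative there. With no chosen edge the residual degree is the target, and
  with every vertex active no pair has to be decided.\<close>

lemma nat_copy:
  assumes P: "remaining_problem d P"
  obtains f and R :: "nat problem"
  where "remaining_problem d R" "complete_cycle_elimination R" "active_iso f P R"
proof -
  let ?p = "perm P"
  obtain f and n :: nat where f: "bij_betw f (active P) {0..<n}"
    using ex_bij_betw_finite_nat[OF finite_active[OF P]] by blast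
  then have inj: "inj_on f (active P)" and onto: "f ` active P = {0..<n}"
    by (auto simp: bij_betw_def)
  define g where "g = inv_into (active P) f"
  have g: "g (f v) = v" if "v \<in> active P" for v
    using inj that by (simp add: g_def)
  \<comment> \<open>The conjugate of \<open>?p\<close> by \<open>f\<close>, extended by the identity
    as \<open>permutes\<close> demands.\<close>
  define q where "q i = (if i < n then f (?p (g i)) else i)" for i
  \<comment> \<open>The conversion \<open>nat\<close> loses nothing below \<open>n\<close>, because
    active residual degrees are positive.\<close>
  define R where "R = \<lparr>verts = {0..<n}, perm = q, target = (\<lambda>i. nat (residual P (g i))),
    active = {0..<n}, decided = {}, chosen = {}\<rparr>"
  have f_less: "f v < n" if "v \<in> active P" for v using onto that by auto
  have q_f: "q (f v) = f (?p v)" if "v \<in> active P" for v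
    using that by (simp add: q_def g f_less)
  have p_active: "?p ` active P = active P"
    using P by (simp add: remaining_problem_def)
  have q_onto: "q ` {0..<n} = {0..<n}"
  proof -
    have "q ` {0..<n} = (\<lambda>v. q (f v)) ` active P" by (simp add: onto[symmetric] image_image)
    also have "\<dots> = f ` ?p ` active P" using q_f by (simp add: image_image)
    finally show ?thesis by (simp add: p_active onto)
  qed
  have q_perm: "q permutes {0..<n}"
  proof (rule bij_imp_permutes)
    show "bij_betw q {0..<n} {0..<n}"
      using q_onto by (simp add: bij_betw_def finite_surj_inj)
  qed (auto simp: q_def)
  have res_range: "1 \<le> residual P v \<and> residual P v \<le> int d" if "v \<in> active P" for v
    using P that by (simp add: remaining_problem_def)
  have res: "residual R (f v) = residual P v" if "v \<in> active P" for v
    using res_range[OF that] by (simp add: R_def residual_def g that)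
  \<comment> \<open>Targets of \<open>R\<close> must be constant on its cycles; this is the
    invariance of the residual degrees of \<open>P\<close> carried over by \<open>f\<close>.\<close>
  have res_step: "residual P (g (q i)) = residual P (g i)" if i: "i < n" for i
  proof -
    obtain v where v: "v \<in> active P" "i = f v" using onto i by force
    then show ?thesis
      using g perm_in_active[OF P v(1)] q_f residual_perm[OF P] active_subset[OF P] by auto
  qed
  have target: "target R u = target R i" if "i < n" "u \<in> orbit q i" for u i
    using that(2)
  proof induct
    case base
    then show ?case using res_step[OF that(1)] by (simp add: R_def)
  next
    case (step u)
    have "u < n" using permutes_orbit_subset[OF q_perm, of i] that(1) step(1) by auto
    with step show ?case using res_step by (simp add: R_def)
  qed
  have R: "verts R = {0..<n}" "perm R = q" "active R = {0..<n}" "decided R = {}" "chosen R = {}"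
    by (simp_all add: R_def)
  have "remaining_problem d R"
  proof -
    have bounds: "\<forall>i\<in>{0..<n}. target R i \<le> d \<and> 1 \<le> residual R i \<and> residual R i \<le> int d"
    proof
      fix i assume "i \<in> {0..<n}"
      then obtain v where v: "v \<in> active P" "i = f v" using onto by blast
      moreover have "target R i = nat (residual P v)" using v g by (simp add: R_def)
      ultimately show "target R i \<le> d \<and> 1 \<le> residual R i \<and> residual R i \<le> int d"
        using res res_range[of v] by auto
    qed
    have cyc: "\<forall>C\<in>cycles R. \<forall>u\<in>C. \<forall>v\<in>C. target R u = target R v"
      using target by (simp add: cycles_def R)
    show ?thesis
      unfolding remaining_problem_def R
      by (intro conjI cyc) (use bounds q_perm q_onto in \<open>auto simp: pairs_invariant_def\<close>)
  qed
  moreover have "complete_cycle_elimination R"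
    by (auto simp: complete_cycle_elimination_def undecided_def R nsets_def)
  moreover have "active_iso f P R"
    using f q_f res by (simp add: active_iso_def R)
  ultimately show thesis by (rule that)
qed

section \<open>Independence of the count and the value of \<open>Phi\<close>\<close>

lemma card_invariant_completions_eq:
  assumes P: "remaining_problem d P" "complete_cycle_elimination P"
    and Q: "remaining_problem d Q" "complete_cycle_elimination Q"
    and "histogram d P = histogram d Q"
  shows "card (invariant_completions P) = card (invariant_completions Q)"
proof -
  obtain f where f: "active_iso f P Q"
    using histogram_eq_imp_active_iso assms by blast
  show ?thesis
    using card_invariant_completions_le[OF P Q f]
      card_invariant_completions_le[OF Q P active_iso_sym[OF P(1) f]] by simp
qed

theorem theorem3p2:
  fixes d :: nat
    and P :: "'a problem"
    and Q :: "'b problem"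
    and H :: "nat \<Rightarrow> nat \<Rightarrow> nat"
  assumes "d \<ge> 1"
    and "remaining_problem d P" and "complete_cycle_elimination P" and "histogram d P = H"
    and "remaining_problem d Q" and "complete_cycle_elimination Q" and "histogram d Q = H"
  shows "card (invariant_completions P) = card (invariant_completions Q) \<and>
         card (invariant_completions P) = Phi d H"
proof
  show "card (invariant_completions P) = card (invariant_completions Q)"
    using assms by (intro card_invariant_completions_eq) auto
  \<comment> \<open>The definite description in \<open>Phi\<close> needs a witness, which is the
    copy \<open>R\<close>, and uniqueness, which is the equality of counts for any competing
    \<open>S\<close>.\<close>
  obtain f and R :: "nat problem" where R: "remaining_problem d R"
    "complete_cycle_elimination R" and f: "active_iso f P R"
    using nat_copy[OF assms(2)] by blast
  have "histogram d R = H"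
    using active_iso_imp_histogram_eq[OF assms(2) R(1) f] assms(4) by simp
  moreover have "card (invariant_completions S) = card (invariant_completions P)"
    if "remaining_problem d S" "complete_cycle_elimination S" "histogram d S = H"
    for S :: "nat problem"
    using that assms by (intro card_invariant_completions_eq) auto
  ultimately show "card (invariant_completions P) = Phi d H"
    unfolding Phi_def using R by (intro the_equality[symmetric]) metis+
qed

end
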